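(* Let $S$ be an inverse semigroup, and let $\mathrm{Sha}(S)$ denote the monoid (under composition) of all order-preserving functions $\eta:S\to S$ that preserve the heap operation, i.e. $(ab^{-1}c)\eta=(a\eta)(b\eta)^{-1}(c\eta)$ for all $a,b,c\in S$. For $\eta\in\mathrm{Sha}(S)$ define $\phi_\eta:S\to S$ by $a\phi_\eta=(a\eta)\big((a^{-1}a)\eta\big)^{-1}$. Then the mapping $\mathrm{Sha}(S)\to\mathrm{Hol}(S)$ given by $\eta\mapsto(\phi_\eta,\eta|_{E(S)})$ is an embedding of monoids, and for all $s\in S$ we have $s\eta=s\lhd(\phi_\eta,\eta|_{E(S)})$.
   Context: Functions are written on the right and composed left to right. $E(S)$ is the set of idempotents of the inverse semigroup $S$, and "order-preserving" refers to the natural partial order ($s\le t$ iff $s=te$ for some $e\in E(S)$). The heap operation is $\langle a,b,c\rangle=ab^{-1}c$. A premorphism $\theta:S\to S$ is a function with $(ab)\theta\le(a\theta)(b\theta)$ for all $a,b\in S$. The holomorph $\mathrm{Hol}(S)$ is the set of pairs $(\alpha,\tau)$ where $\alpha:S\to S$ is a premorphism and $\tau:E(S)\to S$ is order-preserving with $(e\tau)(e\tau)^{-1}=e\alpha$ for all $e\in E(S)$. It is a monoid under $(\alpha,\tau)\diamond(\beta,\sigma)=(\alpha\beta,\tau\beta+\sigma)$ where $e(\tau\beta+\sigma)=\big((e\tau)\beta\big)\big(((e\tau)^{-1}(e\tau))\sigma\big)$ for $e\in E(S)$, and it acts on $S$ by $s\lhd(\alpha,\tau)=(s\alpha)\big((s^{-1}s)\tau\big)$.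 *)

theory Defs
  imports "HOL-Algebra.Group"
begin

class inverse_semigroup = semigroup_mult +
  assumes ex1_inverse: "\<exists>!b. a * b * a = a \<and> b * a * b = b"

definition sinv :: "'a::inverse_semigroup \<Rightarrow> 'a"  (\<open>(_\<inverse>)\<close> [1000] 999)
  where "a\<inverse> = (THE b. a * b * a = a \<and> b * a * b = b)"

definition idempotents :: "'a::inverse_semigroup set"
  where "idempotents = {e. e * e = e}"

definition natural_le :: "'a::inverse_semigroup \<Rightarrow> 'a \<Rightarrow> bool"  (infix \<open>\<preceq>\<close> 50)
  where "s \<preceq> t \<longleftrightarrow> (\<exists>e\<in>idempotents. s = t * e)"

definition heap :: "'a::inverse_semigroup \<Rightarrow> 'a \<Rightarrow> 'a \<Rightarrow> 'a"
  where "heap a b c = a * b\<inverse> * c"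

definition premorphism :: "('a::inverse_semigroup \<Rightarrow> 'a) \<Rightarrow> bool"
  where "premorphism \<theta> \<longleftrightarrow> (\<forall>a b. \<theta> (a * b) \<preceq> \<theta> a * \<theta> b)"

text \<open>
  Maps are written on the right and composed from left to right in the source, so its
  composite \<open>\<eta>\<zeta>\<close> (first \<open>\<eta>\<close>, then \<open>\<zeta>\<close>) is \<open>\<zeta> \<circ> \<eta>\<close> here.
\<close>

definition Sha :: "('a::inverse_semigroup \<Rightarrow> 'a) monoid"
  where "Sha =
    \<lparr>carrier = {\<eta>. monotone_on UNIV (\<preceq>) (\<preceq>) \<eta> \<and>
                   (\<forall>a b c. \<eta> (heap a b c) = heap (\<eta> a) (\<eta> b) (\<eta> c))},
     mult = (\<lambda>\<eta> \<zeta>. \<zeta> \<circ> \<eta>),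
     one = id\<rparr>"

text \<open>
  A map from the set of idempotents to the semigroup is represented by a function that is
  \<^const>\<open>extensional\<close> on \<^const>\<open>idempotents\<close>, so that equality of functions is equality of
  such maps.
\<close>

definition hol_carrier :: "(('a::inverse_semigroup \<Rightarrow> 'a) \<times> ('a \<Rightarrow> 'a)) set"
  where "hol_carrier =
    {(\<alpha>, \<tau>). premorphism \<alpha> \<and>
            \<tau> \<in> extensional idempotents \<and>
            monotone_on idempotents (\<preceq>) (\<preceq>) \<tau> \<and>
            (\<forall>e\<in>idempotents. \<tau> e * (\<tau> e)\<inverse> = \<alpha> e)}"

fun hol_mult ::
  "('a::inverse_semigroup \<Rightarrow> 'a) \<times> ('a \<Rightarrow> 'a) \<Rightarrow> ('a \<Rightarrow> 'a) \<times> ('a \<Rightarrow> 'a)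
     \<Rightarrow> ('a \<Rightarrow> 'a) \<times> ('a \<Rightarrow> 'a)"
  where "hol_mult (\<alpha>, \<tau>) (\<beta>, \<sigma>) =
    (\<beta> \<circ> \<alpha>, restrict (\<lambda>e. \<beta> (\<tau> e) * \<sigma> ((\<tau> e)\<inverse> * \<tau> e)) idempotents)"

definition Hol :: "(('a::inverse_semigroup \<Rightarrow> 'a) \<times> ('a \<Rightarrow> 'a)) monoid"
  where "Hol = \<lparr>carrier = hol_carrier, mult = hol_mult, one = (id, restrict id idempotents)\<rparr>"

fun hol_act :: "'a::inverse_semigroup \<Rightarrow> ('a \<Rightarrow> 'a) \<times> ('a \<Rightarrow> 'a) \<Rightarrow> 'a"  (infixl \<open>\<lhd>\<^sub>H\<close> 70)
  where "s \<lhd>\<^sub>H (\<alpha>, \<tau>) = \<alpha> s * \<tau> (s\<inverse> * s)"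

definition phi :: "('a::inverse_semigroup \<Rightarrow> 'a) \<Rightarrow> 'a \<Rightarrow> 'a"
  where "phi \<eta> a = \<eta> a * (\<eta> (a\<inverse> * a))\<inverse>"

text \<open>The library's \<^const>\<open>hom\<close> does not require preservation of the identity.\<close>

definition monoid_embedding ::
  "('a, 'c) monoid_scheme \<Rightarrow> ('b, 'd) monoid_scheme \<Rightarrow> ('a \<Rightarrow> 'b) \<Rightarrow> bool"
  where "monoid_embedding M N f \<longleftrightarrow>
    monoid M \<and> monoid N \<and> f \<in> hom M N \<and> f \<one>\<^bsub>M\<^esub> = \<one>\<^bsub>N\<^esub> \<and> inj_on f (carrier M)"

end

theory Submission
  imports Defs
begin

text \<open>
  A premorphism preserves idempotents, inverses and the natural order, and it satisfies
  \<open>(xy)\<theta> = (x\<theta>)(y\<theta>)\<close> whenever \<open>x\<inverse>x = yy\<inverse>\<close>; this makes \<open>Hol(S)\<close> a monoid. For a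
  heap-preserving \<open>\<eta>\<close>, writing \<open>ab = a(a\<inverse>a)b\<close> as a heap gives \<open>(ab)\<eta> = (a\<phi>\<^sub>\<eta>)(b\<eta>)\<close>.
  From this identity follow both that \<open>\<phi>\<^sub>\<eta>\<close> is a premorphism and, with \<open>b = a\<inverse>a\<close>, that \<open>\<eta>\<close>
  is the action of its image, so that \<open>\<eta>\<close> is recovered from the pair. The product in
  \<open>a\<eta> = (a\<phi>\<^sub>\<eta>)((a\<inverse>a)\<eta>)\<close> satisfies the above condition, and applying \<open>\<phi>\<^sub>\<zeta>\<close> to it yields
  multiplicativity.
\<close>

unbundle no converse_syntax

section \<open>Inverse semigroups\<close>

lemma sinv_unique:
  fixes a b :: "'a::inverse_semigroup"
  assumes "a * b * a = a" and "b * a * b = b"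
  shows "a\<inverse> = b"
  unfolding sinv_def using assms by (intro the1_equality ex1_inverse) simp

lemma
  fixes a :: "'a::inverse_semigroup"
  shows mult_sinv_mult: "a * a\<inverse> * a = a" and sinv_mult_sinv: "a\<inverse> * a * a\<inverse> = a\<inverse>"
  using theI'[OF ex1_inverse[of a]] unfolding sinv_def by auto

lemma sinv_cancel [simp]:
  fixes a :: "'a::inverse_semigroup"
  shows "a * (a\<inverse> * a) = a" "a\<inverse> * (a * a\<inverse>) = a\<inverse>"
    "a * (a\<inverse> * (a * b)) = a * b" "a\<inverse> * (a * (a\<inverse> * b)) = a\<inverse> * b"
  using mult_sinv_mult[of a] sinv_mult_sinv[of a] by (metis mult.assoc)+

lemma sinv_sinv [simp]: "(a\<inverse>)\<inverse> = (a::'a::inverse_semigroup)"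
  by (rule sinv_unique) (simp_all add: mult.assoc)

lemma idempotentsD: "e \<in> idempotents \<Longrightarrow> e * e = e"
  by (simp add: idempotents_def)

lemma idempotent_left: "e \<in> idempotents \<Longrightarrow> e * (e * b) = e * b"
  by (metis idempotentsD mult.assoc)

lemma sinv_idempotent: "e \<in> idempotents \<Longrightarrow> e\<inverse> = e"
  by (rule sinv_unique) (simp_all add: idempotentsD)

lemma
  fixes a :: "'a::inverse_semigroup"
  shows mult_sinv_idempotent [simp]: "a * a\<inverse> \<in> idempotents"
    and sinv_mult_idempotent [simp]: "a\<inverse> * a \<in> idempotents"
  by (simp_all add: idempotents_def mult.assoc)

text \<open>The unique inverse \<open>x\<close> of \<open>ef\<close> equals \<open>fxe\<close>, hence is idempotent, hence equals \<open>ef\<close>.\<close>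

lemma idempotents_mult:
  fixes e f :: "'a::inverse_semigroup"
  assumes e: "e \<in> idempotents" and f: "f \<in> idempotents"
  shows "e * f \<in> idempotents"
proof -
  define x where "x = (e * f)\<inverse>"
  have 1: "e * (f * (x * (e * f))) = e * f" and 2: "x * (e * (f * x)) = x"
    using mult_sinv_mult[of "e * f"] sinv_mult_sinv[of "e * f"]
    by (simp_all add: x_def mult.assoc)
  have 3: "x * (e * (f * (x * z))) = x * z" for z
    using 2 by (metis mult.assoc)
  have "x = f * x * e"
    unfolding x_def[symmetric]
    by (subst x_def, rule sinv_unique)
      (simp_all add: mult.assoc idempotent_left[OF e] idempotent_left[OF f] 1 3)
  then have "x * x = x"
    using 3 by (metis mult.assoc)
  then have "x\<inverse> = x"
    by (intro sinv_idempotent) (simp add: idempotents_def)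
  then show ?thesis
    using \<open>x * x = x\<close> by (simp add: x_def idempotents_def)
qed

text \<open>Since \<open>e * f\<close> and \<open>f * e\<close> are both idempotent,
  \<open>f * e\<close> is an inverse of \<open>e * f\<close>. But \<open>e * f\<close>, being
  idempotent, is its own inverse.\<close>

lemma idempotents_commute:
  fixes e f :: "'a::inverse_semigroup"
  assumes e: "e \<in> idempotents" and f: "f \<in> idempotents"
  shows "e * f = f * e"
proof -
  have "e * (f * (e * f)) = e * f" "f * (e * (f * e)) = f * e"
    using idempotents_mult[OF e f] idempotents_mult[OF f e]
    by (simp_all add: idempotents_def mult.assoc)
  then have "(e * f)\<inverse> = f * e"
    by (intro sinv_unique)
      (simp_all add: mult.assoc idempotent_left[OF e] idempotent_left[OF f])
  then show ?thesis
    using sinv_idempotent[OF idempotents_mult[OF e f]] by simp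
qed

lemma sinv_mult:
  fixes a b :: "'a::inverse_semigroup"
  shows "(a * b)\<inverse> = b\<inverse> * a\<inverse>"
proof (rule sinv_unique)
  \<comment> \<open>Swapping these two idempotents in the middle lets each be absorbed by the outer
    factor next to it.\<close>
  have c: "b * b\<inverse> * (a\<inverse> * a) = a\<inverse> * a * (b * b\<inverse>)"
    by (rule idempotents_commute) simp_all
  have "a * b * (b\<inverse> * a\<inverse>) * (a * b) = a * (b * b\<inverse> * (a\<inverse> * a)) * b"
    by (simp add: mult.assoc)
  then show "a * b * (b\<inverse> * a\<inverse>) * (a * b) = a * b"
    unfolding c by (simp add: mult.assoc)
  have "b\<inverse> * a\<inverse> * (a * b) * (b\<inverse> * a\<inverse>) = b\<inverse> * (a\<inverse> * a * (b * b\<inverse>)) * a\<inverse>"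
    by (simp add: mult.assoc)
  then show "b\<inverse> * a\<inverse> * (a * b) * (b\<inverse> * a\<inverse>) = b\<inverse> * a\<inverse>"
    unfolding c[symmetric] by (simp add: mult.assoc)
qed

lemma idempotent_conj:
  fixes a :: "'a::inverse_semigroup"
  assumes "e \<in> idempotents"
  shows "a * e * a\<inverse> \<in> idempotents"
proof -
  have "a * e * a\<inverse> * (a * e * a\<inverse>) = a * (e * (a\<inverse> * a)) * e * a\<inverse>"
    by (simp add: mult.assoc)
  also have "\<dots> = a * e * a\<inverse>"
    using idempotents_commute[OF assms sinv_mult_idempotent[of a]] assms
    by (simp add: mult.assoc idempotent_left)
  finally show ?thesis
    by (simp add: idempotents_def)
qed

lemma mult_idempotent_swap:
  fixes a :: "'a::inverse_semigroup"
  assumes "e \<in> idempotents"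
  shows "a * e = a * e * a\<inverse> * a"
  using idempotents_commute[OF assms sinv_mult_idempotent[of a]]
  by (metis mult.assoc mult_sinv_mult)

section \<open>The natural partial order\<close>

lemma natural_leI: "e \<in> idempotents \<Longrightarrow> s = t * e \<Longrightarrow> s \<preceq> t"
  by (auto simp: natural_le_def)

lemma natural_leI':
  assumes "e \<in> idempotents" "s = e * t"
  shows "s \<preceq> t"
proof (rule natural_leI)
  \<comment> \<open>Conjugation by \<open>t\<close> carries \<open>e\<close> across:
    \<open>e * t = t * (t\<inverse> * e * t)\<close>.\<close>
  show "t\<inverse> * e * t \<in> idempotents"
    using idempotent_conj[OF assms(1), of "t\<inverse>"] by simp
  have "e * t = e * (t * t\<inverse>) * t"
    by (simp add: mult.assoc)
  also have "\<dots> = t * t\<inverse> * e * t"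
    by (simp add: idempotents_commute[OF assms(1)])
  finally show "s = t * (t\<inverse> * e * t)"
    by (simp add: assms(2) mult.assoc)
qed

lemma natural_leE':
  assumes "s \<preceq> t"
  obtains e where "e \<in> idempotents" "s = e * t"
  using assms mult_idempotent_swap idempotent_conj unfolding natural_le_def by metis

lemma natural_le_refl [simp]: "s \<preceq> s"
  by (rule natural_leI[of "s\<inverse> * s"]) simp_all

lemma natural_le_trans [trans]: "r \<preceq> s \<Longrightarrow> s \<preceq> t \<Longrightarrow> r \<preceq> t"
  unfolding natural_le_def by (metis idempotents_mult mult.assoc)

text \<open>A canonical witness for the order: any witness \<open>e\<close> satisfies
  \<open>s * e = s\<close>, so it absorbs \<open>s\<inverse> * s\<close> and can be replaced by
  it.\<close>

lemma natural_le_dom: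
  assumes "s \<preceq> t"
  shows "s = t * (s\<inverse> * s)"
proof -
  obtain e where e: "e \<in> idempotents" and s: "s = t * e"
    using assms by (auto simp: natural_le_def)
  have "s * e = s"
    by (simp add: s mult.assoc idempotentsD[OF e])
  then have "e * (s\<inverse> * s) = s\<inverse> * s"
    using idempotents_commute[OF e sinv_mult_idempotent[of s]] by (metis mult.assoc)
  then show ?thesis
    using s by (metis mult.assoc mult_sinv_mult)
qed

lemma natural_le_antisym:
  assumes "s \<preceq> t" "t \<preceq> s"
  shows "s = t"
proof -
  obtain e f where e: "e \<in> idempotents" "s = t * e" and f: "f \<in> idempotents" "t = s * f"
    using assms by (auto simp: natural_le_def)
  have "s = s * f * e"
    using e f by simp
  also have "\<dots> = s * e * f"
    using idempotents_commute[OF e(1) f(1)] by (simp add: mult.assoc)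
  also have "s * e = s"
    using e by (simp add: mult.assoc idempotentsD)
  finally show ?thesis
    using f by simp
qed

lemma natural_le_mult_left: "s \<preceq> t \<Longrightarrow> a * s \<preceq> a * t"
  unfolding natural_le_def by (metis mult.assoc)

lemma natural_le_mult_right: "s \<preceq> t \<Longrightarrow> s * a \<preceq> t * a"
  by (metis natural_leE' natural_leI' mult.assoc)

lemma natural_le_mult: "s \<preceq> t \<Longrightarrow> u \<preceq> v \<Longrightarrow> s * u \<preceq> t * v"
  by (meson natural_le_trans natural_le_mult_left natural_le_mult_right)

lemma natural_le_sinv: "s \<preceq> t \<Longrightarrow> s\<inverse> \<preceq> t\<inverse>"
  by (metis natural_leI' natural_le_def sinv_idempotent sinv_mult)

lemma mult_idempotent_le: "e \<in> idempotents \<Longrightarrow> a * e \<preceq> a"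
  by (rule natural_leI) simp_all

lemma idempotent_mult_le: "e \<in> idempotents \<Longrightarrow> e * a \<preceq> a"
  by (rule natural_leI') simp_all

lemma idempotent_mult_eq: "a \<preceq> e * a \<Longrightarrow> e \<in> idempotents \<Longrightarrow> e * a = a"
  by (meson natural_le_antisym idempotent_mult_le)

text \<open>An element below \<open>t\<close> is determined by its range idempotent, as
  \<open>s = s * s\<inverse> * t\<close>. This is how inequalities of premorphisms become
  equations.\<close>

lemma natural_le_eqI:
  assumes "s \<preceq> t" "t * t\<inverse> \<preceq> s * s\<inverse>"
  shows "s = t"
proof -
  have "s\<inverse> \<preceq> t\<inverse>"
    using assms(1) by (rule natural_le_sinv)
  have "t = t * t\<inverse> * t"
    by (simp add: mult_sinv_mult)
  also have "\<dots> \<preceq> s * s\<inverse> * t"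
    using assms(2) by (rule natural_le_mult_right)
  also have "s * s\<inverse> * t = s"
    \<comment> \<open>This gives \<open>s\<inverse> = t\<inverse> * (s * s\<inverse>)\<close>; now
      take inverses.\<close>
    using natural_le_dom[OF \<open>s\<inverse> \<preceq> t\<inverse>\<close>]
    by (metis sinv_mult sinv_sinv mult.assoc)
  finally show ?thesis
    using assms(1) natural_le_antisym by blast
qed

text \<open>
  Products with \<open>x\<inverse>x = yy\<inverse>\<close> are the composites of the groupoid underlying an inverse
  semigroup.
\<close>

lemma
  fixes x y :: "'a::inverse_semigroup"
  assumes "x\<inverse> * x = y * y\<inverse>"
  shows composable_range: "(x * y) * (x * y)\<inverse> = x * x\<inverse>"
    and composable_domain: "(x * y)\<inverse> * (x * y) = y\<inverse> * y"
proof -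
  have "(x * y) * (x * y)\<inverse> = x * (y * y\<inverse>) * x\<inverse>"
    by (simp add: sinv_mult mult.assoc)
  then show "(x * y) * (x * y)\<inverse> = x * x\<inverse>"
    unfolding assms[symmetric] by (simp add: mult.assoc)
  have "(x * y)\<inverse> * (x * y) = y\<inverse> * (x\<inverse> * x) * y"
    by (simp add: sinv_mult mult.assoc)
  then show "(x * y)\<inverse> * (x * y) = y\<inverse> * y"
    unfolding assms by (simp add: mult.assoc)
qed

section \<open>Premorphisms\<close>

lemma premorphismD: "premorphism \<theta> \<Longrightarrow> \<theta> (a * b) \<preceq> \<theta> a * \<theta> b"
  by (simp add: premorphism_def)

lemma le_inverse_pair:
  assumes "x \<preceq> x * y * x"
  shows "x * y * x = x"
  using natural_le_dom[OF assms] by (simp add: mult.assoc)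

lemma premorphism_idempotent:
  assumes "premorphism \<theta>" "e \<in> idempotents"
  shows "\<theta> e \<in> idempotents"
proof -
  have "\<theta> e \<preceq> \<theta> e * \<theta> e"
    using premorphismD[OF assms(1), of e e] assms(2) by (simp add: idempotentsD)
  \<comment> \<open>Here the canonical form reads \<open>\<theta> e = \<theta> e * \<theta> e *
    (\<theta> e)\<inverse> * \<theta> e\<close>, whose right-hand side collapses to
    \<open>\<theta> e * \<theta> e\<close>.\<close>
  from natural_le_dom[OF this] show ?thesis
    by (simp add: idempotents_def mult.assoc)
qed

text \<open>Two uses of the premorphism inequality on \<open>b * b\<inverse> * b\<close> give one
  half of the inverse equations up to \<preceq>, and \<open>le_inverse_pair\<close> sharpens it.
  Taking \<open>b\<close> to be \<open>a\<close> and then \<open>a\<inverse>\<close> gives both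
  halves.\<close>

lemma premorphism_sinv:
  assumes "premorphism \<theta>"
  shows "\<theta> (a\<inverse>) = (\<theta> a)\<inverse>"
proof -
  have *: "\<theta> b * \<theta> (b\<inverse>) * \<theta> b = \<theta> b" for b
  proof (rule le_inverse_pair)
    have "\<theta> b \<preceq> \<theta> (b * b\<inverse>) * \<theta> b"
      using premorphismD[OF assms, of "b * b\<inverse>" b] by (simp add: mult_sinv_mult)
    also have "\<dots> \<preceq> \<theta> b * \<theta> (b\<inverse>) * \<theta> b"
      by (intro natural_le_mult_right premorphismD[OF assms])
    finally show "\<theta> b \<preceq> \<theta> b * \<theta> (b\<inverse>) * \<theta> b" .
  qed
  have "(\<theta> a)\<inverse> = \<theta> (a\<inverse>)"
    using *[of a] *[of "a\<inverse>"] by (intro sinv_unique) simp_all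
  then show ?thesis
    by simp
qed

lemma premorphism_mono:
  assumes "premorphism \<theta>" "s \<preceq> t"
  shows "\<theta> s \<preceq> \<theta> t"
  using assms unfolding natural_le_def[of s t]
  by (metis mult_idempotent_le natural_le_trans premorphismD premorphism_idempotent)

lemma premorphism_range:
  assumes "premorphism \<theta>"
  shows "\<theta> (a * a\<inverse>) = \<theta> a * (\<theta> a)\<inverse>"
proof (rule natural_le_antisym)
  show "\<theta> (a * a\<inverse>) \<preceq> \<theta> a * (\<theta> a)\<inverse>"
    using premorphismD[OF assms, of a "a\<inverse>"] by (simp add: premorphism_sinv[OF assms])
  have i: "\<theta> (a * a\<inverse>) \<in> idempotents"
    by (rule premorphism_idempotent[OF assms]) simp
  \<comment> \<open>For the other direction, the idempotent
    \<open>\<theta> (a * a\<inverse>)\<close> fixes \<open>\<theta> a\<close> on the left, so it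
    lies above the range idempotent of \<open>\<theta> a\<close>.\<close>
  have "\<theta> a \<preceq> \<theta> (a * a\<inverse>) * \<theta> a"
    using premorphismD[OF assms, of "a * a\<inverse>" a] by (simp add: mult_sinv_mult)
  then have "\<theta> (a * a\<inverse>) * \<theta> a = \<theta> a"
    using i by (rule idempotent_mult_eq)
  then have "\<theta> a * (\<theta> a)\<inverse> = \<theta> (a * a\<inverse>) * (\<theta> a * (\<theta> a)\<inverse>)"
    by (metis mult.assoc)
  then show "\<theta> a * (\<theta> a)\<inverse> \<preceq> \<theta> (a * a\<inverse>)"
    by (metis mult_idempotent_le mult_sinv_idempotent)
qed

lemma premorphism_domain:
  assumes "premorphism \<theta>"
  shows "\<theta> (a\<inverse> * a) = (\<theta> a)\<inverse> * \<theta> a"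
  using premorphism_range[OF assms, of "a\<inverse>"] by (simp add: premorphism_sinv[OF assms])

text \<open>One inequality is the definition. Composability makes the range idempotents of both
  sides equal to that of \<open>\<theta> x\<close>, which forces equality.\<close>

lemma premorphism_composable:
  assumes "premorphism \<theta>" "x\<inverse> * x = y * y\<inverse>"
  shows "\<theta> (x * y) = \<theta> x * \<theta> y"
proof (rule natural_le_eqI)
  show "\<theta> (x * y) \<preceq> \<theta> x * \<theta> y"
    by (rule premorphismD[OF assms(1)])
  have "(\<theta> x)\<inverse> * \<theta> x = \<theta> y * (\<theta> y)\<inverse>"
    using assms by (metis premorphism_domain premorphism_range)
  then have "\<theta> x * \<theta> y * (\<theta> x * \<theta> y)\<inverse> = \<theta> x * (\<theta> x)\<inverse>"
    by (rule composable_range)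
  also have "\<dots> = \<theta> (x * y) * (\<theta> (x * y))\<inverse>"
    using assms by (metis composable_range premorphism_range)
  finally show "\<theta> x * \<theta> y * (\<theta> x * \<theta> y)\<inverse> \<preceq> \<theta> (x * y) * (\<theta> (x * y))\<inverse>"
    by simp
qed

lemma premorphism_comp:
  assumes "premorphism \<alpha>" "premorphism \<beta>"
  shows "premorphism (\<beta> \<circ> \<alpha>)"
  using assms unfolding premorphism_def o_def
  by (meson natural_le_trans premorphism_mono assms(2))

section \<open>The holomorph\<close>

lemma hol_carrierD:
  assumes "(\<alpha>, \<tau>) \<in> hol_carrier"
  shows "premorphism \<alpha>" "\<tau> \<in> extensional idempotents"
    "\<lbrakk>e \<in> idempotents; f \<in> idempotents; e \<preceq> f\<rbrakk> \<Longrightarrow> \<tau> e \<preceq> \<tau> f"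
    "e \<in> idempotents \<Longrightarrow> \<tau> e * (\<tau> e)\<inverse> = \<alpha> e"
  using assms by (auto simp: hol_carrier_def monotone_on_def)

text \<open>Makes the product in the second component of \<open>hol_mult\<close> a groupoid
  composite, so that its range and domain can be read off its factors.\<close>

lemma hol_composable:
  assumes "(\<beta>, \<sigma>) \<in> hol_carrier"
  shows "(\<beta> x)\<inverse> * \<beta> x = \<sigma> (x\<inverse> * x) * (\<sigma> (x\<inverse> * x))\<inverse>"
  using hol_carrierD(1)[OF assms] hol_carrierD(4)[OF assms, of "x\<inverse> * x"]
  by (simp add: premorphism_domain)

lemma hol_mult_closed:
  assumes "p \<in> hol_carrier" "q \<in> hol_carrier"
  shows "hol_mult p q \<in> hol_carrier"
proof -
  obtain \<alpha> \<tau> \<beta> \<sigma> where pq: "p = (\<alpha>, \<tau>)" "q = (\<beta>, \<sigma>)"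
    by (cases p, cases q)
  note P = hol_carrierD[OF assms(1)[unfolded pq]] and Q = hol_carrierD[OF assms(2)[unfolded pq]]
  let ?\<rho> = "\<lambda>e. \<beta> (\<tau> e) * \<sigma> ((\<tau> e)\<inverse> * \<tau> e)"
  have "?\<rho> e \<preceq> ?\<rho> f" if "e \<in> idempotents" "f \<in> idempotents" "e \<preceq> f" for e f
    by (intro natural_le_mult premorphism_mono[OF Q(1)] Q(3) natural_le_sinv P(3) that) simp_all
  \<comment> \<open>The composite has the range of its left factor
    \<open>\<beta> (\<tau> e)\<close>, and \<open>\<beta>\<close> commutes with taking
    ranges.\<close>
  moreover have "?\<rho> e * (?\<rho> e)\<inverse> = \<beta> (\<alpha> e)" if "e \<in> idempotents" for e
    using composable_range[OF hol_composable[OF assms(2)[unfolded pq]]]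
      premorphism_range[OF Q(1), of "\<tau> e"] P(4)[OF that] by simp
  ultimately show ?thesis
    using premorphism_comp[OF P(1) Q(1)] unfolding pq
    by (simp add: hol_carrier_def monotone_on_def)
qed

lemma hol_mult_assoc:
  assumes "p \<in> hol_carrier" "q \<in> hol_carrier" "r \<in> hol_carrier"
  shows "hol_mult (hol_mult p q) r = hol_mult p (hol_mult q r)"
proof -
  obtain \<alpha> \<tau> \<beta> \<sigma> \<gamma> \<rho> where pqr: "p = (\<alpha>, \<tau>)" "q = (\<beta>, \<sigma>)" "r = (\<gamma>, \<rho>)"
    by (cases p, cases q, cases r)
  note Q = hol_carrierD[OF assms(2)[unfolded pqr]] and R = hol_carrierD[OF assms(3)[unfolded pqr]]
  have c: "(\<beta> x)\<inverse> * \<beta> x = \<sigma> (x\<inverse> * x) * (\<sigma> (x\<inverse> * x))\<inverse>" for x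
    using assms(2)[unfolded pqr] by (rule hol_composable)
  \<comment> \<open>Two facts align the second components: \<open>\<gamma>\<close> distributes over
    the composite, and the composite has the domain of its \<open>\<sigma>\<close> factor, at which
    \<open>\<rho>\<close> is evaluated.\<close>
  show ?thesis
    unfolding pqr hol_mult.simps
    by (auto intro!: restrict_ext
        simp: comp_assoc composable_domain[OF c] premorphism_composable[OF R(1) c] mult.assoc)
qed

lemma monoid_Hol: "monoid (Hol :: (('a::inverse_semigroup \<Rightarrow> 'a) \<times> ('a \<Rightarrow> 'a)) monoid)"
proof
  fix p q r :: "('a \<Rightarrow> 'a) \<times> ('a \<Rightarrow> 'a)"
  assume *: "p \<in> carrier Hol" "q \<in> carrier Hol"
  then show "p \<otimes>\<^bsub>Hol\<^esub> q \<in> carrier Hol"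
    by (simp add: Hol_def hol_mult_closed)
  assume "r \<in> carrier Hol"
  with * show "p \<otimes>\<^bsub>Hol\<^esub> q \<otimes>\<^bsub>Hol\<^esub> r = p \<otimes>\<^bsub>Hol\<^esub> (q \<otimes>\<^bsub>Hol\<^esub> r)"
    by (simp add: Hol_def hol_mult_assoc)
next
  show "\<one>\<^bsub>Hol\<^esub> \<in> carrier (Hol :: (('a \<Rightarrow> 'a) \<times> ('a \<Rightarrow> 'a)) monoid)"
    by (simp add: Hol_def hol_carrier_def premorphism_def monotone_on_def
        sinv_idempotent idempotentsD)
next
  fix p :: "('a \<Rightarrow> 'a) \<times> ('a \<Rightarrow> 'a)"
  assume p: "p \<in> carrier Hol"
  obtain \<alpha> \<tau> where [simp]: "p = (\<alpha>, \<tau>)"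
    by (cases p)
  have "(\<alpha>, \<tau>) \<in> hol_carrier"
    using p by (simp add: Hol_def)
  note P = hol_carrierD[OF this]
  \<comment> \<open>The range condition makes \<open>\<alpha> e\<close> a left identity for
    \<open>\<tau> e\<close>.\<close>
  have "\<alpha> e * \<tau> (e\<inverse> * e) = \<tau> e" if "e \<in> idempotents" for e
    using P(4)[OF that, symmetric] that
    by (simp add: sinv_idempotent idempotentsD mult_sinv_mult)
  then have "restrict (\<lambda>e. \<alpha> (restrict id idempotents e) *
      \<tau> ((restrict id idempotents e)\<inverse> * restrict id idempotents e)) idempotents = \<tau>"
    by (intro extensionalityI[OF restrict_extensional P(2)]) simp
  then show "\<one>\<^bsub>Hol\<^esub> \<otimes>\<^bsub>Hol\<^esub> p = p"
    by (simp add: Hol_def)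
  have "restrict (\<lambda>e. id (\<tau> e) * restrict id idempotents ((\<tau> e)\<inverse> * \<tau> e)) idempotents = \<tau>"
    by (intro extensionalityI[OF restrict_extensional P(2)]) simp
  then show "p \<otimes>\<^bsub>Hol\<^esub> \<one>\<^bsub>Hol\<^esub> = p"
    by (simp add: Hol_def)
qed

section \<open>Order-preserving heap endomorphisms\<close>

lemma ShaD:
  assumes "\<eta> \<in> carrier Sha"
  shows "s \<preceq> t \<Longrightarrow> \<eta> s \<preceq> \<eta> t" "\<eta> (a * b\<inverse> * c) = \<eta> a * (\<eta> b)\<inverse> * \<eta> c"
  using assms by (auto simp: Sha_def monotone_on_def heap_def)

lemma monoid_Sha: "monoid (Sha :: ('a::inverse_semigroup \<Rightarrow> 'a) monoid)"
  by unfold_locales (auto simp: Sha_def monotone_on_def)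

lemma Sha_mult:
  assumes "\<eta> \<in> carrier Sha"
  shows "\<eta> (a * b) = phi \<eta> a * \<eta> b"
  using ShaD(2)[OF assms, of a "a\<inverse> * a" b]
  by (simp add: phi_def sinv_mult mult.assoc)

lemma Sha_eq_act:
  assumes "\<eta> \<in> carrier Sha"
  shows "\<eta> s = phi \<eta> s * \<eta> (s\<inverse> * s)"
  using Sha_mult[OF assms, of s "s\<inverse> * s"] by simp

lemma phi_idempotent: "e \<in> idempotents \<Longrightarrow> phi \<eta> e = \<eta> e * (\<eta> e)\<inverse>"
  by (simp add: phi_def sinv_idempotent idempotentsD)

lemma premorphism_phi:
  fixes \<eta> :: "'a::inverse_semigroup \<Rightarrow> 'a"
  assumes "\<eta> \<in> carrier Sha"
  shows "premorphism (phi \<eta>)"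
  unfolding premorphism_def
proof (intro allI)
  fix a b :: 'a
  \<comment> \<open>By \<open>Sha_mult\<close> both sides begin with
    \<open>phi \<eta> a * \<eta> b\<close>. Only the values of \<open>\<eta>\<close> at two domain
    idempotents remain to be compared, which is where order preservation enters.\<close>
  have "(a * b)\<inverse> * (a * b) = b\<inverse> * (a\<inverse> * a) * b"
    by (simp add: sinv_mult mult.assoc)
  also have "\<dots> \<preceq> b\<inverse> * b"
    by (intro natural_le_mult_right mult_idempotent_le) simp
  finally have "(\<eta> ((a * b)\<inverse> * (a * b)))\<inverse> \<preceq> (\<eta> (b\<inverse> * b))\<inverse>"
    by (intro natural_le_sinv ShaD(1)[OF assms])
  then have "phi \<eta> a * \<eta> b * (\<eta> ((a * b)\<inverse> * (a * b)))\<inverse> \<preceq> phi \<eta> a * \<eta> b * (\<eta> (b\<inverse> * b))\<inverse>"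
    by (rule natural_le_mult_left)
  then show "phi \<eta> (a * b) \<preceq> phi \<eta> a * phi \<eta> b"
    by (simp add: phi_def[of \<eta> "a * b"] phi_def[of \<eta> b] Sha_mult[OF assms] mult.assoc)
qed

text \<open>A premorphism commutes with taking domains, and on idempotents \<open>phi \<eta>\<close>
  gives the range of \<open>\<eta>\<close>. Hence the factorisation in \<open>Sha_eq_act\<close> is
  a groupoid composite.\<close>

lemma phi_composable:
  assumes "\<eta> \<in> carrier Sha"
  shows "(phi \<eta> s)\<inverse> * phi \<eta> s = \<eta> (s\<inverse> * s) * (\<eta> (s\<inverse> * s))\<inverse>"
  by (simp add: premorphism_domain[OF premorphism_phi[OF assms], symmetric] phi_idempotent)

lemma phi_range:
  assumes "\<eta> \<in> carrier Sha"
  shows "\<eta> s * (\<eta> s)\<inverse> = phi \<eta> (s * s\<inverse>)"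
  using composable_range[OF phi_composable[OF assms, of s]]
  by (simp add: Sha_eq_act[OF assms, symmetric] premorphism_range[OF premorphism_phi[OF assms]])

lemma phi_comp:
  assumes \<eta>: "\<eta> \<in> carrier Sha" and \<zeta>: "\<zeta> \<in> carrier Sha"
  shows "phi (\<zeta> \<circ> \<eta>) a = phi \<zeta> (phi \<eta> a)"
proof -
  note pre = premorphism_phi[OF \<zeta>]
  define y where "y = \<eta> (a\<inverse> * a)"
  have "\<zeta> (\<eta> a) = phi \<zeta> (phi \<eta> a) * \<zeta> y"
    using Sha_mult[OF \<zeta>, of "phi \<eta> a" y] Sha_eq_act[OF \<eta>, of a] by (simp add: y_def)
  \<comment> \<open>Multiplying the previous equation on the right by
    \<open>(\<zeta> y)\<inverse>\<close> leaves \<open>phi \<zeta> (phi \<eta> a)\<close> times its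
    own domain idempotent, which is absorbed.\<close>
  moreover have "\<zeta> y * (\<zeta> y)\<inverse> = (phi \<zeta> (phi \<eta> a))\<inverse> * phi \<zeta> (phi \<eta> a)"
    using phi_range[OF \<zeta>, of y] phi_composable[OF \<eta>, of a]
      premorphism_domain[OF pre, of "phi \<eta> a"] by (simp add: y_def)
  ultimately show ?thesis
    by (simp add: phi_def[of "\<zeta> \<circ> \<eta>"] y_def[symmetric] mult.assoc)
qed

theorem proposition4p2:
  shows "monoid_embedding (Sha :: ('a::inverse_semigroup \<Rightarrow> 'a) monoid) Hol
           (\<lambda>\<eta>. (phi \<eta>, restrict \<eta> idempotents)) \<and>
         (\<forall>\<eta>\<in>carrier (Sha :: ('a \<Rightarrow> 'a) monoid). \<forall>s.
           \<eta> s = s \<lhd>\<^sub>H (phi \<eta>, restrict \<eta> idempotents))"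
proof -
  let ?F = "\<lambda>\<eta> :: 'a \<Rightarrow> 'a. (phi \<eta>, restrict \<eta> idempotents)"
  have act: "\<eta> s = s \<lhd>\<^sub>H ?F \<eta>" if "\<eta> \<in> carrier Sha" for \<eta> s
    using Sha_eq_act[OF that, of s] by simp
  have "?F \<in> hom Sha Hol"
  proof (rule homI)
    fix \<eta> :: "'a \<Rightarrow> 'a"
    assume \<eta>: "\<eta> \<in> carrier Sha"
    then show "?F \<eta> \<in> carrier Hol"
      by (simp add: Hol_def hol_carrier_def monotone_on_def ShaD(1) premorphism_phi
          phi_idempotent)
    fix \<zeta> :: "'a \<Rightarrow> 'a"
    assume \<zeta>: "\<zeta> \<in> carrier Sha"
    have "phi (\<zeta> \<circ> \<eta>) = phi \<zeta> \<circ> phi \<eta>"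
      using phi_comp[OF \<eta> \<zeta>] by auto
    \<comment> \<open>The second components agree at \<open>e\<close> by \<open>Sha_eq_act\<close>
      for \<open>\<zeta>\<close> at the element \<open>\<eta> e\<close>.\<close>
    then show "?F (\<eta> \<otimes>\<^bsub>Sha\<^esub> \<zeta>) = ?F \<eta> \<otimes>\<^bsub>Hol\<^esub> ?F \<zeta>"
      using Sha_eq_act[OF \<zeta>, symmetric] by (auto simp: Sha_def Hol_def intro!: restrict_ext)
  qed
  moreover have "?F \<one>\<^bsub>Sha\<^esub> = \<one>\<^bsub>Hol\<^esub>"
    by (auto simp: Sha_def Hol_def phi_def sinv_mult mult.assoc)
  moreover have "inj_on ?F (carrier Sha)"
  proof (rule inj_onI)
    fix \<eta> \<zeta> :: "'a \<Rightarrow> 'a"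
    assume "\<eta> \<in> carrier Sha" "\<zeta> \<in> carrier Sha" "?F \<eta> = ?F \<zeta>"
    then show "\<eta> = \<zeta>"
      using act by (metis ext)
  qed
  ultimately show ?thesis
    using monoid_Sha monoid_Hol act unfolding monoid_embedding_def by blast
qed

end
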